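(* For any finite partially ordered sets $P$ and $Q$ one has a homeomorphism $$|P\times Q|\cong|P|\times|Q|.$$
   Context: The product $P\times Q$ of partially ordered sets is the product set with the order $(x,y)\ge(z,w)$ if $x\ge z$ and $y\ge w$. The right-hand side carries the product topology. Geometric realization of a finite partially ordered set $P$: consider $P$ as a metric space by the discrete metric $d(x,y)=1-\delta_{xy}$. Then $|P|$ is the set of all order preserving (weakly monotone) upper semi-continuous maps $f:I=[0,1]\to P$ (for order preserving $f$, whose image is a finite chain, upper semi-continuity means that $\{t\in I: f(t)\ge p\}$ is closed for every $p$ in the image of $f$), given the structure of a metric space by the metric $d(f,g)=\int_0^1 d(f(t),g(t))\,dt$. *)

theory Defs
  imports "HOL-Analysis.Analysis" "HOL-Library.Product_Order"
begin

text \<open>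
  A finite poset is a finite subset of a type of class \<^class>\<open>order\<close>, with the induced order; it may
  be empty. The points of its realization are maps on the unit interval, represented as
  extensional functions, so that distinct points differ somewhere on the interval.
\<close>

definition upper_semicontinuous_on :: "real set \<Rightarrow> (real \<Rightarrow> 'a::order) \<Rightarrow> bool"
  where "upper_semicontinuous_on I f \<longleftrightarrow> (\<forall>p \<in> f ` I. closedin (top_of_set I) {t \<in> I. f t \<ge> p})"

definition realization :: "'a::order set \<Rightarrow> (real \<Rightarrow> 'a) set"
  where "realization P =
    {f \<in> {0..1} \<rightarrow>\<^sub>E P. mono_on {0..1} f \<and> upper_semicontinuous_on {0..1} f}"

definition realization_dist :: "(real \<Rightarrow> 'a) \<Rightarrow> (real \<Rightarrow> 'a) \<Rightarrow> real"
  where "realization_dist f g = integral {0..1} (\<lambda>t. discrete_metric.dd (f t) (g t))"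

text \<open>
  Two points of the realization that differ only at the endpoint \<open>1\<close> are at distance \<open>0\<close> (for
  instance, if \<open>x < y\<close>, the constant map \<open>x\<close> and the map that is \<open>x\<close> on \<open>[0,1)\<close> and \<open>y\<close> at \<open>1\<close>), so
  \<^const>\<open>realization_dist\<close> is in general only a pseudometric and the locale
  \<^locale>\<open>Metric_space\<close> cannot be interpreted. The topology is the one induced by this
  pseudometric, defined as in that locale.
\<close>

definition realization_topology :: "'a::order set \<Rightarrow> (real \<Rightarrow> 'a) topology"
  where "realization_topology P = topology (\<lambda>U. U \<subseteq> realization P \<and>
    (\<forall>f \<in> U. \<exists>r>0. {g \<in> realization P. realization_dist f g < r} \<subseteq> U))"

lemma openin_realization_topology:
  "openin (realization_topology P) U \<longleftrightarrow> U \<subseteq> realization P \<and>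
    (\<forall>f \<in> U. \<exists>r>0. {g \<in> realization P. realization_dist f g < r} \<subseteq> U)"
proof -
  define B where "B f r = {g \<in> realization P. realization_dist f g < r}" for f r
  define opn where
    "opn U \<longleftrightarrow> U \<subseteq> realization P \<and> (\<forall>f \<in> U. \<exists>r>0. B f r \<subseteq> U)" for U
  have "opn (S \<inter> T)" if S: "opn S" and T: "opn T" for S T
    unfolding opn_def
  proof (intro conjI ballI)
    show "S \<inter> T \<subseteq> realization P"
      using S unfolding opn_def by blast
    fix f assume f: "f \<in> S \<inter> T"
    obtain r where r: "r > 0" "B f r \<subseteq> S"
      using S f unfolding opn_def by blast
    obtain s where s: "s > 0" "B f s \<subseteq> T"
      using T f unfolding opn_def by blast
    have "B f (min r s) \<subseteq> B f r" "B f (min r s) \<subseteq> B f s"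
      unfolding B_def by auto
    then have "B f (min r s) \<subseteq> S \<inter> T"
      using r s by blast
    then show "\<exists>r>0. B f r \<subseteq> S \<inter> T"
      using r(1) s(1) by (intro exI[of _ "min r s"]) simp
  qed
  moreover have "opn (\<Union>\<K>)" if K: "\<forall>K\<in>\<K>. opn K" for \<K>
    unfolding opn_def
  proof (intro conjI ballI)
    show "\<Union>\<K> \<subseteq> realization P"
      using K unfolding opn_def by blast
    fix f assume "f \<in> \<Union>\<K>"
    then obtain A where A: "A \<in> \<K>" "f \<in> A" by blast
    then obtain r where "r > 0" "B f r \<subseteq> A"
      using K unfolding opn_def by blast
    then show "\<exists>r>0. B f r \<subseteq> \<Union>\<K>"
      using A(1) by blast
  qed
  ultimately have "istopology opn"
    unfolding istopology_def by blast
  moreover have "realization_topology P = topology opn"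
    unfolding realization_topology_def opn_def B_def ..
  ultimately show ?thesis
    by (simp add: topology_inverse' opn_def B_def)
qed

end

theory Submission imports Defs begin

text \<open>
  Composing with the projections turns a point of \<open>|P \<times> Q|\<close> into a pair of points. Both
  directions preserve upper semicontinuity: the image of a monotone map is a finite chain, so the
  preimage of an up-set is the preimage of a principal up-set. Continuity comes from comparing
  distances: each projection does not increase them, and the distance in \<open>|P \<times> Q|\<close> is at most
  the sum of the two component distances.
\<close>

lemma realizationD:
  assumes "f \<in> realization P"
  shows "\<And>t. t \<in> {0..1} \<Longrightarrow> f t \<in> P"
    and "mono_on {0..1} f"
    and "\<And>p. p \<in> f ` {0..1} \<Longrightarrow> closedin (top_of_set {0..1}) {t \<in> {0..1}. f t \<ge> p}"
    and "\<And>t. t \<notin> {0..1} \<Longrightarrow> f t = undefined"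
  using assms unfolding realization_def upper_semicontinuous_on_def
  by (auto simp: PiE_def extensional_def)

lemma realization_eqI:
  assumes "f \<in> realization P" "g \<in> realization P" "\<And>t. t \<in> {0..1} \<Longrightarrow> f t = g t"
  shows "f = g"
proof
  show "f t = g t" for t
    using assms by (cases "t \<in> {0..1}") (simp_all add: realizationD(4) del: atLeastAtMost_iff)
qed

text \<open>By antisymmetry a monotone map that takes the value \<open>p\<close> at both ends of an
  interval is constantly \<open>p\<close> between them. Fibers are therefore bounded
  intervals.\<close>

lemma lmeasurable_fiber:
  fixes f :: "real \<Rightarrow> 'a::order"
  assumes "mono_on {0..1} f"
  shows "{t \<in> {0..1}. f t = p} \<in> lmeasurable"
proof (rule measurable_convex)
  have "f t = p" if "s \<in> {0..1}" "u \<in> {0..1}" "f s = p" "f u = p" "s \<le> t" "t \<le> u" for s t u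
    using that mono_onD[OF assms, of s t] mono_onD[OF assms, of t u] by auto
  then have "is_interval {t \<in> {0..1}. f t = p}"
    unfolding is_interval_1 by auto
  then show "convex {t \<in> {0..1}. f t = p}"
    by (simp add: is_interval_convex_1)
  show "bounded {t \<in> {0..1}. f t = p}"
    by (rule bounded_subset[of "{0..1}"]) auto
qed

text \<open>An integral has the default value 0 when the integrand is not integrable, so every later
  comparison of distances depends on this fact.\<close>

lemma dd_integrable:
  assumes "finite P" "f \<in> realization P" "g \<in> realization P"
  shows "(\<lambda>t. discrete_metric.dd (f t) (g t)) integrable_on {0..1}"
proof -
  \<comment> \<open>The set where \<open>f\<close> and \<open>g\<close> agree, split by their common
    value: a finite union of measurable sets. The integrand is the indicator of its
    complement.\<close>
  let ?E = "\<Union>p\<in>P. {t \<in> {0..1}. f t = p} \<inter> {t \<in> {0..1}. g t = p}"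
  have "?E \<in> lmeasurable"
    using assms realizationD(2) by (intro fmeasurable.finite_UN fmeasurable.Int lmeasurable_fiber) auto
  then have "{0..1} - ?E \<in> lmeasurable"
    by (intro fmeasurable.Diff) auto
  moreover have "{0..1} \<inter> ({0..1} - ?E) = {0..1} - ?E" by auto
  ultimately have "indicat_real ({0..1} - ?E) integrable_on {0..1}"
    by (simp add: integrable_on_indicator Int_commute)
  then show ?thesis
    by (rule integrable_eq)
      (use realizationD(1)[OF assms(2)] in \<open>auto simp: discrete_metric.dd_def indicator_def\<close>)
qed

lemma realization_dist_self: "realization_dist f f = 0"
  by (simp add: realization_dist_def discrete_metric.dd_def)

lemma realization_dist_triangle:
  assumes "finite P" "f \<in> realization P" "g \<in> realization P" "h \<in> realization P"
  shows "realization_dist f h \<le> realization_dist f g + realization_dist g h"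
proof -
  note int = dd_integrable[OF assms(1)]
  have "realization_dist f h \<le>
      integral {0..1} (\<lambda>t. discrete_metric.dd (f t) (g t) + discrete_metric.dd (g t) (h t))"
    unfolding realization_dist_def
    using assms by (intro integral_le integrable_add int) (auto simp: discrete_metric.dd_def)
  then show ?thesis
    by (simp add: Henstock_Kurzweil_Integration.integral_add int assms realization_dist_def)
qed

lemma topspace_realization: "topspace (realization_topology P) = realization P"
proof
  show "topspace (realization_topology P) \<subseteq> realization P"
    using openin_realization_topology openin_topspace by blast
  have "openin (realization_topology P) (realization P)"
    by (auto simp: openin_realization_topology intro: exI[of _ 1])
  then show "realization P \<subseteq> topspace (realization_topology P)"
    by (rule openin_subset)
qed

text \<open>Supplies the neighbourhoods in the two factors when continuity of the pairing map is
  shown. By the triangle inequality, a ball around \<open>g\<close> fits inside if its radius is the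
  remaining margin \<open>r - realization_dist f g\<close>.\<close>

lemma openin_realization_ball:
  assumes "finite P" "f \<in> realization P"
  shows "openin (realization_topology P) {g \<in> realization P. realization_dist f g < r}"
  unfolding openin_realization_topology
proof (intro conjI ballI)
  fix g assume g: "g \<in> {g \<in> realization P. realization_dist f g < r}"
  show "\<exists>s>0. {h \<in> realization P. realization_dist g h < s} \<subseteq> {g \<in> realization P. realization_dist f g < r}"
  proof (intro exI conjI subsetI)
    show "r - realization_dist f g > 0" using g by simp
    fix h assume "h \<in> {h \<in> realization P. realization_dist g h < r - realization_dist f g}"
    then show "h \<in> {g \<in> realization P. realization_dist f g < r}"
      using realization_dist_triangle[OF assms, of g h] g by auto
  qed
qed auto

text \<open>Stated for an arbitrary monotone map between posets so that one argument serves both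
  projections.\<close>

lemma realization_compose:
  assumes "finite P" and \<phi>: "mono_on P \<phi>" "\<phi> ` P \<subseteq> Q" and f: "f \<in> realization P"
  shows "restrict (\<phi> \<circ> f) {0..1} \<in> realization Q"
proof -
  note fP = realizationD(1)[OF f] and mono = realizationD(2)[OF f]
  have "closedin (top_of_set {0..1}) {t \<in> {0..1}. \<phi> (f t) \<ge> q}"
    if q: "q \<in> \<phi> ` f ` {0..1}" for q
  proof -
    \<comment> \<open>Semicontinuity of \<open>f\<close> speaks only of elements of its image, so
      the threshold \<open>q\<close> has to be traded for some \<open>m\<close> in that image. As
      \<open>q\<close> is attained by the composite, \<open>?A\<close> is nonempty.\<close>
    let ?A = "{p \<in> f ` {0..1}. \<phi> p \<ge> q}"
    have "finite ?A"
      using fP by (intro finite_subset[OF _ \<open>finite P\<close>]) auto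
    moreover have "?A \<noteq> {}" using q by auto
    ultimately obtain m where m: "m \<in> ?A" "\<And>p. p \<in> ?A \<Longrightarrow> p \<le> m \<Longrightarrow> m = p"
      using finite_has_minimal[of ?A] by blast
    \<comment> \<open>Any two parameters are comparable, so the image of \<open>f\<close> is a
      chain, and in a chain a minimal element is least.\<close>
    have least: "m \<le> p" if p: "p \<in> ?A" for p
    proof -
      obtain s t where "s \<in> {0..1}" "t \<in> {0..1}" "p = f s" "m = f t"
        using p m(1) by auto
      then have "p \<le> m \<or> m \<le> p"
        using mono_onD[OF mono, of s t] mono_onD[OF mono, of t s] by (cases s t rule: le_cases) auto
      then show ?thesis using m(2)[OF p] by auto
    qed
    have "\<phi> (f t) \<ge> q \<longleftrightarrow> f t \<ge> m" if t: "t \<in> {0..1}" for t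
    proof
      assume "m \<le> f t"
      then have "\<phi> m \<le> \<phi> (f t)"
        using m(1) fP t by (intro mono_onD[OF \<phi>(1)]) auto
      then show "q \<le> \<phi> (f t)" using m(1) by auto
    qed (use least t in auto)
    then have "{t \<in> {0..1}. \<phi> (f t) \<ge> q} = {t \<in> {0..1}. f t \<ge> m}" by blast
    then show ?thesis using realizationD(3)[OF f, of m] m(1) by auto
  qed
  then have "upper_semicontinuous_on {0..1} (restrict (\<phi> \<circ> f) {0..1})"
    unfolding upper_semicontinuous_on_def by (auto simp: image_comp cong: conj_cong)
  moreover have "mono_on {0..1} (restrict (\<phi> \<circ> f) {0..1})"
    by (rule mono_onI) (simp add: fP mono_onD[OF \<phi>(1)] mono_onD[OF mono])
  ultimately show ?thesis
    using fP \<phi>(2) by (auto simp: realization_def)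
qed

text \<open>Where the images under \<open>\<phi>\<close> differ, the arguments differ already.
  Postcomposition is thus 1-Lipschitz, and any radius that works in the target works in the
  source.\<close>

lemma continuous_map_realization_compose:
  assumes "finite P" "finite Q" and \<phi>: "mono_on P \<phi>" "\<phi> ` P \<subseteq> Q"
  shows "continuous_map (realization_topology P) (realization_topology Q)
    (\<lambda>f. restrict (\<phi> \<circ> f) {0..1})"
    (is "continuous_map _ _ ?F")
proof -
  have F: "?F f \<in> realization Q" if "f \<in> realization P" for f
    using realization_compose[OF assms(1) \<phi> that] .
  have dist: "realization_dist (?F f) (?F g) \<le> realization_dist f g"
    if "f \<in> realization P" "g \<in> realization P" for f g
    unfolding realization_dist_def
    using that by (intro integral_le dd_integrable[OF assms(2)] dd_integrable[OF assms(1)] F)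
      (auto simp: discrete_metric.dd_def)
  have "openin (realization_topology P) {f \<in> realization P. ?F f \<in> U}"
    if U: "openin (realization_topology Q) U" for U
    unfolding openin_realization_topology
  proof (intro conjI ballI)
    fix f assume f: "f \<in> {f \<in> realization P. ?F f \<in> U}"
    then obtain r where "r > 0" "{g \<in> realization Q. realization_dist (?F f) g < r} \<subseteq> U"
      using U unfolding openin_realization_topology by blast
    then show "\<exists>r>0. {g \<in> realization P. realization_dist f g < r} \<subseteq> {f \<in> realization P. ?F f \<in> U}"
      using f F dist by (intro exI[of _ r]) fastforce
  qed auto
  then show ?thesis
    using F by (auto simp: continuous_map_def topspace_realization)
qed

text \<open>A principal up-set of the product is a product of principal up-sets, so its preimage is
  an intersection of two closed sets.\<close>

lemma realization_pair:
  assumes f: "f \<in> realization P" and g: "g \<in> realization Q"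
  shows "(\<lambda>t\<in>{0..1}. (f t, g t)) \<in> realization (P \<times> Q)"
proof -
  have "closedin (top_of_set {0..1}) {t \<in> {0..1}. (f t, g t) \<ge> (f s, g s)}"
    if "s \<in> {0..1}" for s
  proof -
    have "{t \<in> {0..1}. (f t, g t) \<ge> (f s, g s)} =
        {t \<in> {0..1}. f t \<ge> f s} \<inter> {t \<in> {0..1}. g t \<ge> g s}"
      by auto
    then show ?thesis
      using that realizationD(3)[OF f, of "f s"] realizationD(3)[OF g, of "g s"]
      by (simp add: closedin_Int)
  qed
  then have "upper_semicontinuous_on {0..1} (\<lambda>t\<in>{0..1}. (f t, g t))"
    unfolding upper_semicontinuous_on_def by (auto cong: conj_cong)
  moreover have "mono_on {0..1} (\<lambda>t\<in>{0..1}. (f t, g t))"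
    using realizationD(2)[OF f] realizationD(2)[OF g] by (auto simp: mono_on_def)
  ultimately show ?thesis
    using realizationD(1)[OF f] realizationD(1)[OF g] by (auto simp: realization_def)
qed

text \<open>Two pairs differ only where at least one component differs, which bounds the integrand
  by the sum of the two component integrands.\<close>

lemma realization_dist_pair:
  assumes "finite P" "finite Q"
    and "f \<in> realization P" "f' \<in> realization P" "g \<in> realization Q" "g' \<in> realization Q"
  shows "realization_dist (\<lambda>t\<in>{0..1}. (f t, g t)) (\<lambda>t\<in>{0..1}. (f' t, g' t))
    \<le> realization_dist f f' + realization_dist g g'"
proof -
  note int = dd_integrable[OF assms(1)] dd_integrable[OF assms(2)]
    dd_integrable[OF finite_cartesian_product[OF assms(1,2)]]
  have "realization_dist (\<lambda>t\<in>{0..1}. (f t, g t)) (\<lambda>t\<in>{0..1}. (f' t, g' t)) \<le>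
      integral {0..1} (\<lambda>t. discrete_metric.dd (f t) (f' t) + discrete_metric.dd (g t) (g' t))"
    unfolding realization_dist_def
    by (intro integral_le integrable_add int realization_pair assms)
      (auto simp: discrete_metric.dd_def)
  then show ?thesis
    by (simp add: Henstock_Kurzweil_Integration.integral_add int assms realization_dist_def)
qed

lemma continuous_map_realization_pair:
  assumes fin: "finite P" "finite Q"
  shows "continuous_map (prod_topology (realization_topology P) (realization_topology Q))
    (realization_topology (P \<times> Q)) (\<lambda>(f, g). \<lambda>t\<in>{0..1}. (f t, g t))"
    (is "continuous_map ?X _ ?G")
proof -
  have "openin ?X {x \<in> topspace ?X. ?G x \<in> U}"
    if U: "openin (realization_topology (P \<times> Q)) U" for U
    unfolding openin_prod_topology_alt
  proof (intro allI impI)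
    fix f g assume "(f, g) \<in> {x \<in> topspace ?X. ?G x \<in> U}"
    then have fg: "f \<in> realization P" "g \<in> realization Q" "?G (f, g) \<in> U"
      by (auto simp: topspace_realization)
    then obtain r where r: "r > 0"
      and sub: "{h \<in> realization (P \<times> Q). realization_dist (?G (f, g)) h < r} \<subseteq> U"
      using U unfolding openin_realization_topology by blast
    \<comment> \<open>Each factor gets half of the radius, since the distance of pairs is at most
      the sum of the component distances.\<close>
    define V where "V = {f' \<in> realization P. realization_dist f f' < r / 2}"
    define W where "W = {g' \<in> realization Q. realization_dist g g' < r / 2}"
    have "?G (f', g') \<in> U" if "f' \<in> V" "g' \<in> W" for f' g'
    proof -
      have "realization_dist (?G (f, g)) (?G (f', g')) < r"
        using that realization_dist_pair[OF fin fg(1) _ fg(2), of f' g']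
        by (simp add: V_def W_def)
      moreover have "?G (f', g') \<in> realization (P \<times> Q)"
        using that by (simp add: V_def W_def realization_pair)
      ultimately show ?thesis using sub by blast
    qed
    then have "V \<times> W \<subseteq> {x \<in> topspace ?X. ?G x \<in> U}"
      by (auto simp: V_def W_def topspace_realization)
    moreover have "f \<in> V" "g \<in> W"
      using fg r by (auto simp: V_def W_def realization_dist_self)
    moreover have "openin (realization_topology P) V" "openin (realization_topology Q) W"
      unfolding V_def W_def using openin_realization_ball fin fg by blast+
    ultimately show "\<exists>V W. openin (realization_topology P) V \<and>
        openin (realization_topology Q) W \<and> f \<in> V \<and> g \<in> W \<and>
        V \<times> W \<subseteq> {x \<in> topspace ?X. ?G x \<in> U}"
      by blast
  qed
  then show ?thesis
    by (auto simp: continuous_map_def topspace_realization realization_pair)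
qed

theorem lemma3p6:
  fixes P :: "'a::order set" and Q :: "'b::order set"
  assumes "finite P" and "finite Q"
  shows "realization_topology (P \<times> Q) homeomorphic_space
    prod_topology (realization_topology P) (realization_topology Q)"
proof -
  let ?F = "\<lambda>h. (restrict (fst \<circ> h) {0..1}, restrict (snd \<circ> h) {0..1})"
  let ?G = "\<lambda>(f, g). \<lambda>t\<in>{0..1}. (f t, g t)"
  have fin: "finite (P \<times> Q)" using assms by simp
  have proj: "mono_on (P \<times> Q) fst" "fst ` (P \<times> Q) \<subseteq> P" "mono_on (P \<times> Q) snd" "snd ` (P \<times> Q) \<subseteq> Q"
    by (auto simp: mono_on_def)
  have "continuous_map (realization_topology (P \<times> Q))
      (prod_topology (realization_topology P) (realization_topology Q)) ?F"
    by (intro continuous_map_pairedI continuous_map_realization_compose fin assms proj)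
  \<comment> \<open>On the interval both round trips are the identity of pairs. Outside it all maps
    are \<open>undefined\<close> by extensionality; the restriction in \<open>?G\<close> matters
    here, as the \<open>undefined\<close> of the product type need not be the pair of the two
    component ones.\<close>
  moreover have "?G (?F h) = h" if h: "h \<in> realization (P \<times> Q)" for h
    using h realization_pair[OF realization_compose[OF fin proj(1,2) h]
        realization_compose[OF fin proj(3,4) h]]
    by (auto intro: realization_eqI)
  moreover have "?F (?G (f, g)) = (f, g)" if "f \<in> realization P" "g \<in> realization Q" for f g
    using realizationD(4)[OF that(1)] realizationD(4)[OF that(2)] by (auto simp: restrict_def)
  ultimately have "homeomorphic_maps (realization_topology (P \<times> Q))
      (prod_topology (realization_topology P) (realization_topology Q)) ?F ?G"
    using continuous_map_realization_pair[OF assms]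
    by (auto simp: homeomorphic_maps_def topspace_realization)
  then show ?thesis
    unfolding homeomorphic_space_def by blast
qed

end
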